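(* Let the sequence $(b_0,b_1,\ldots)$ be defined by $b_0:=0$ and $b_k:=B_{k-1}$ for $k\ge1$, where $B_j$ are the Bernoulli numbers. Then for all $n\ge1$, $$H_n(b_k)=\frac{2\cdot(2n+1)!}{n!^3}\cdot\mathcal{H}_{2,n}^{-}\cdot H_n(B_k),\qquad\text{where}\quad \mathcal{H}_{2,n}^{-}:=\sum_{j=1}^n\frac{(-1)^{j-1}}{j^2}.$$
   Context: For a sequence $(a_k)_{k\ge 0}$ and $n\ge 0$, $H_n(a_k):=\det(a_{i+j})_{0\le i,j\le n}$ denotes the $(n+1)\times(n+1)$ Hankel determinant. The Bernoulli numbers are defined by $\frac{t}{e^t-1}=\sum_{n\ge0}B_n\frac{t^n}{n!}$ (so $B_1=-1/2$). *)

theory Defs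
  imports
    "HOL-Computational_Algebra.Formal_Power_Series"
    "Jordan_Normal_Form.Determinant"
begin

definition hankel_det :: "(nat \<Rightarrow> real) \<Rightarrow> nat \<Rightarrow> real" where
  "hankel_det a n = Determinant.det (Matrix.mat (n + 1) (n + 1) (\<lambda>(i, j). a (i + j)))"

(* t / (exp t - 1) as a formal power series. The denominator is not a unit; division of
   formal power series over a field first cancels the common factor t, so this is the
   genuine quotient (see bernoulli_egf). *)
definition bernoulli :: "nat \<Rightarrow> real" where
  "bernoulli n = fact n * fps_nth (fps_X / (fps_exp 1 - 1)) n"

lemma bernoulli_egf:
  "Abs_fps (\<lambda>n. bernoulli n / fact n) * (fps_exp 1 - 1) = fps_X"
proof -
  let ?g = "fps_exp 1 - 1 :: real fps"
  have nz: "fps_nth ?g 1 \<noteq> 0" by simp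
  have "subdegree ?g = 1"
    by (rule subdegreeI) (use nz in auto)
  then have "?g dvd fps_X"
    using nz by (subst fps_dvd_iff) (auto simp del: fps_sub_nth)
  moreover have "Abs_fps (\<lambda>n. bernoulli n / fact n) = fps_X / ?g"
    by (simp add: bernoulli_def fps_eq_iff)
  ultimately show ?thesis by simp
qed

definition shifted_bernoulli :: "nat \<Rightarrow> real" where
  "shifted_bernoulli k = (if k = 0 then 0 else bernoulli (k - 1))"

definition alternating_harmonic2 :: "nat \<Rightarrow> real" where
  "alternating_harmonic2 n = (\<Sum>j = 1..n. (-1) ^ (j - 1) / (real j)\<^sup>2)"

end

theory Submission
  imports Defs
begin

text \<open>
  Let \<open>L\<close> be the linear functional with \<open>L (x ^ k) = B k\<close>. Since \<open>L (p (x + 1) - p x) = p' 0\<close>, it maps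
  the binomial polynomial \<open>x choose k\<close> to \<open>(-1) ^ k / (k + 1)\<close>, the integral of \<open>(-t) ^ k\<close> over the
  unit interval. Hence the polynomials \<open>Q n\<close> whose coefficients in the binomial basis are those of
  the shifted Legendre polynomials are orthogonal for \<open>L\<close>. The functional \<open>N\<close> of the shifted sequence
  satisfies \<open>N (x p) = L p\<close>, so in the basis \<open>Q n\<close> both Hankel matrices become triangular up to one
  row, and the quotient of the determinants is \<open>(-1) ^ n N (Q n) / L (x ^ n Q n)\<close>. The three-term
  recurrence of \<open>Q n\<close> evaluates both quantities; the differences \<open>N (Q (n + 1)) - N (Q n)\<close> produce
  the alternating sum.
\<close>

section \<open>Moment functionals\<close>

text \<open>Multiplying the argument by \<open>x ^ i\<close> amounts to shifting the sequence, so
  \<open>L (x ^ i * p)\<close> is always written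
  \<open>moment (\<lambda>k. a (i + k)) p\<close>.\<close>

definition moment :: "(nat \<Rightarrow> 'a::comm_ring_1) \<Rightarrow> 'a poly \<Rightarrow> 'a" where
  "moment a p = (\<Sum>k\<le>degree p. coeff p k * a k)"

lemma moment_eq_sum:
  assumes "degree p \<le> m"
  shows "moment a p = (\<Sum>k\<le>m. coeff p k * a k)"
  unfolding moment_def using assms
  by (intro sum.mono_neutral_left) (auto simp: coeff_eq_0)

lemma moment_0 [simp]: "moment a 0 = 0"
  by (simp add: moment_def)

lemma moment_add: "moment a (p + q) = moment a p + moment a q"
proof -
  let ?m = "max (degree p) (degree q)"
  have "degree (p + q) \<le> ?m"
    by (rule degree_add_le_max)
  then show ?thesis
    by (simp add: moment_eq_sum[of _ ?m] sum.distrib algebra_simps)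
qed

lemma moment_smult: "moment a (smult c p) = c * moment a p"
  using moment_eq_sum[OF degree_smult_le[of c p], of a]
  by (simp add: moment_def sum_distrib_left mult.assoc)

lemma moment_sum: "moment a (\<Sum>i\<in>A. f i) = (\<Sum>i\<in>A. moment a (f i))"
  by (induction A rule: infinite_finite_induct) (auto simp: moment_add)

lemma moment_pCons: "moment a (pCons c p) = c * a 0 + moment (\<lambda>k. a (Suc k)) p"
proof -
  have "moment a (pCons c p) = (\<Sum>k\<le>Suc (degree p). coeff (pCons c p) k * a k)"
    by (rule moment_eq_sum[OF degree_pCons_le])
  then show ?thesis
    by (simp only: sum.atMost_Suc_shift) (simp add: moment_def)
qed

lemma moment_monom: "moment a (monom c n) = c * a n"
  by (simp add: moment_eq_sum[OF degree_monom_le] if_distrib[of "\<lambda>x. x * _"] cong: if_cong)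

text \<open>Column operations: the Hankel matrix times the coefficient matrix of the
  \<open>q j\<close> has the moments of \<open>x ^ i * q j\<close> as entries. The degree bound
  makes the second factor upper triangular.\<close>

lemma hankel_det_triangular_basis:
  assumes deg: "\<And>j. degree (q j) \<le> j"
  shows "hankel_det a n * (\<Prod>j<Suc n. coeff (q j) j) =
    det (mat (Suc n) (Suc n) (\<lambda>(i, j). moment (\<lambda>k. a (i + k)) (q j)))"
proof -
  let ?A = "mat (Suc n) (Suc n) (\<lambda>(i, j). a (i + j))"
  let ?C = "mat (Suc n) (Suc n) (\<lambda>(i, j). coeff (q j) i)"
  have "det ?C = prod_list (diag_mat ?C)"
  proof (rule det_upper_triangular)
    show "upper_triangular ?C"
      unfolding upper_triangular_def using le_less_trans[OF deg] by (auto intro: coeff_eq_0)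
  qed auto
  also have "\<dots> = (\<Prod>j<Suc n. coeff (q j) j)"
    by (simp add: prod_list_diag_prod atLeast0LessThan del: prod.lessThan_Suc)
  finally have C: "det ?C = (\<Prod>j<Suc n. coeff (q j) j)" .
  have "?A * ?C = mat (Suc n) (Suc n) (\<lambda>(i, j). moment (\<lambda>k. a (i + k)) (q j))"
  proof (rule eq_matI)
    fix i j
    assume "i < dim_row (mat (Suc n) (Suc n) (\<lambda>(i, j). moment (\<lambda>k. a (i + k)) (q j)))"
      and "j < dim_col (mat (Suc n) (Suc n) (\<lambda>(i, j). moment (\<lambda>k. a (i + k)) (q j)))"
    then have ij: "i < Suc n" "j < Suc n" by auto
    then have "degree (q j) \<le> n"
      using deg[of j] by linarith
    then show "(?A * ?C) $$ (i, j) =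
        mat (Suc n) (Suc n) (\<lambda>(i, j). moment (\<lambda>k. a (i + k)) (q j)) $$ (i, j)"
      using ij by (simp add: moment_eq_sum scalar_prod_def atLeast0LessThan lessThan_Suc_atMost
          mult.commute del: sum.atMost_Suc sum.lessThan_Suc)
  qed auto
  then show ?thesis
    using det_mult[of ?A "Suc n" ?C] C by (simp add: hankel_det_def del: prod.lessThan_Suc)
qed

section \<open>The binomial basis\<close>

text \<open>Coefficient of \<open>t ^ n\<close> in \<open>bernoulli_egf\<close>, scaled by
  \<open>fact n\<close>; the term \<open>k = n\<close> drops out because \<open>exp t - 1\<close>
  has no constant term.\<close>

lemma bernoulli_binomial_sum:
  "(\<Sum>k<n. of_nat (n choose k) * bernoulli k) = (if n = 1 then 1 else 0)"
proof -
  have "(\<Sum>k=0..n. bernoulli k / fact k * (fps_nth (fps_exp 1 - 1) (n - k))) =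
      (if n = 1 then 1 else 0)"
    using arg_cong[OF bernoulli_egf, of "\<lambda>f. fps_nth f n"] by (simp add: fps_mult_nth)
  moreover have "(\<Sum>k=0..n. bernoulli k / fact k * (fps_nth (fps_exp 1 - 1) (n - k))) =
      (\<Sum>k<n. bernoulli k / fact k / fact (n - k))"
    by (rule sum.mono_neutral_cong_right) auto
  ultimately have "(\<Sum>k<n. bernoulli k / fact k / fact (n - k)) = (if n = 1 then 1 else 0)"
    by (simp only:)
  moreover have "(\<Sum>k<n. of_nat (n choose k) * bernoulli k) =
      fact n * (\<Sum>k<n. bernoulli k / fact k / fact (n - k))"
    unfolding sum_distrib_left by (intro sum.cong) (auto simp: binomial_fact)
  ultimately show ?thesis by simp
qed

lemma smult_sum_right: "smult c (\<Sum>i\<in>A. f i) = (\<Sum>i\<in>A. smult c (f i))"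
  by (induction A rule: infinite_finite_induct) (auto simp: smult_add_right)

text \<open>By linearity monomials suffice, and there the binomial theorem reduces the claim to
  \<open>bernoulli_binomial_sum\<close>.\<close>

lemma moment_bernoulli_shift:
  "moment bernoulli (pcompose p [:1, 1:] - p) = coeff p 1"
proof -
  have monomial: "moment bernoulli (pcompose (monom 1 n) [:1, 1:] - monom 1 n) = (if n = 1 then 1 else 0)"
    for n
  proof -
    have "pcompose (monom 1 n) [:1, 1:] = ([:1, 1:] :: real poly) ^ n"
      by (induction n) (simp_all add: monom_0 monom_Suc pcompose_pCons pcompose_1)
    also have "\<dots> = (monom 1 1 + 1) ^ n"
      by (simp add: monom_altdef one_pCons)
    also have "\<dots> = (\<Sum>k\<le>n. monom (of_nat (n choose k)) k)"
      by (simp add: binomial_ring monom_power of_nat_monom mult_monom)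
    also have "\<dots> = (\<Sum>k<n. monom (of_nat (n choose k)) k) + monom 1 n"
      by (simp flip: lessThan_Suc_atMost)
    finally show ?thesis
      using bernoulli_binomial_sum[of n] by (simp add: moment_sum moment_monom)
  qed
  let ?S = "\<Sum>i\<le>degree p. smult (coeff p i) (monom 1 i)"
  have p: "?S = p"
    by (simp add: smult_monom poly_as_sum_of_monoms)
  have "pcompose ?S [:1, 1:] - ?S =
      (\<Sum>i\<le>degree p. smult (coeff p i) (pcompose (monom 1 i) [:1, 1:] - monom 1 i))"
    by (simp only: pcompose_sum pcompose_smult smult_diff_right sum_subtractf)
  then have "moment bernoulli (pcompose p [:1, 1:] - p) =
      (\<Sum>i\<le>degree p. coeff p i * moment bernoulli (pcompose (monom 1 i) [:1, 1:] - monom 1 i))"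
    by (simp only: p moment_sum moment_smult)
  also have "\<dots> = coeff p 1"
    by (auto simp: monomial if_distrib[of "\<lambda>x. _ * x"] coeff_eq_0 cong: if_cong)
  finally show ?thesis .
qed

primrec binomial_poly :: "nat \<Rightarrow> real poly" where
  "binomial_poly 0 = 1"
| "binomial_poly (Suc k) = smult (1 / (real k + 1)) ([:- real k, 1:] * binomial_poly k)"

text \<open>Multiplication by \<open>x\<close> in the binomial basis: the defining recursion solved
  for \<open>x * binomial_poly k\<close>.\<close>

lemma pCons_0_binomial_poly:
  "pCons 0 (binomial_poly k) =
    smult (real k + 1) (binomial_poly (Suc k)) + smult (real k) (binomial_poly k)"
  by (simp add: nonzero_mult_div_cancel_left add_pos_nonneg less_imp_neq[symmetric])

lemma degree_binomial_poly: "degree (binomial_poly k) = k"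
proof (induction k)
  case (Suc k)
  then have "binomial_poly k \<noteq> 0 \<or> k = 0" by auto
  with Suc show ?case
    by (auto simp: degree_mult_eq simp del: mult_pCons_left)
qed simp

lemma lead_coeff_binomial_poly: "coeff (binomial_poly k) k = 1 / fact k"
proof (induction k)
  case (Suc k)
  then show ?case
    using degree_binomial_poly[of k] by (simp add: coeff_eq_0)
qed simp

text \<open>Pascal's rule, by induction: the shift turns the factor \<open>x - (k + 1)\<close> into
  \<open>x - k\<close>.\<close>

lemma binomial_poly_shift:
  "pcompose (binomial_poly (Suc k)) [:1, 1:] - binomial_poly (Suc k) = binomial_poly k"
proof (induction k)
  case (Suc k)
  let ?b = "binomial_poly (Suc k)"
  have b: "[:- real k, 1:] * binomial_poly k = smult (real k + 1) ?b"
    by (simp add: add_nonneg_eq_0_iff del: mult_pCons_left)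
  have "pcompose ?b [:1, 1:] = ?b + binomial_poly k"
    using Suc by (simp only: diff_eq_eq add.commute)
  moreover have "pcompose [:- real (Suc k), 1:] [:1, 1:] = [:- real k, 1:]"
    by (simp add: pcompose_pCons)
  ultimately have "pcompose (binomial_poly (Suc (Suc k))) [:1, 1:] =
      smult (1 / (real k + 2)) ([:- real k, 1:] * (?b + binomial_poly k))"
    by (subst binomial_poly.simps(2)) (simp only: pcompose_smult pcompose_mult, simp add: add.commute)
  also have "\<dots> = smult (1 / (real k + 2)) ([:- real k, 1:] * ?b + smult (real k + 1) ?b)"
    by (simp only: distrib_left b)
  \<comment> \<open>Both sides equal \<open>(x + 1) * ?b\<close>; the new split exposes the
    recursion for \<open>binomial_poly (Suc (Suc k))\<close> and leaves exactly \<open>?b\<close>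
    after the division by \<open>k + 2\<close>.\<close>
  also have "[:- real k, 1:] * ?b + smult (real k + 1) ?b =
      [:- real (Suc k), 1:] * ?b + smult (real k + 2) ?b"
    by (rule poly_eqI) (simp add: algebra_simps del: binomial_poly.simps)
  finally show ?case
    by (subst (2) binomial_poly.simps(2))
      (simp add: smult_add_right add_nonneg_eq_0_iff add.commute del: binomial_poly.simps mult_pCons_left)
qed (simp add: pcompose_pCons)

lemma coeff_binomial_poly_0: "coeff (binomial_poly (Suc k)) 0 = 0"
  by (induction k) auto

lemma coeff_binomial_poly_1: "coeff (binomial_poly (Suc k)) 1 = (-1) ^ k / (real k + 1)"
proof (induction k)
  case (Suc k)
  have "coeff (binomial_poly (Suc (Suc k))) 1 =
      - (real k + 1) / (real k + 2) * coeff (binomial_poly (Suc k)) 1"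
    using coeff_binomial_poly_0[of k]
    by (subst binomial_poly.simps(2)) (simp del: binomial_poly.simps add: add.commute)
  also have "\<dots> = (-1) ^ Suc k / (real k + 2)"
  proof -
    have "- a / b * (s / a) = - s / b" if "a \<noteq> 0" for a b s :: real
      using that by simp
    from this[of "real k + 1" "real k + 2" "(-1) ^ k"] show ?thesis
      unfolding Suc by (simp only: power_Suc)
  qed
  finally show ?case by (simp del: binomial_poly.simps add: add.commute)
qed simp

lemma moment_bernoulli_binomial_poly:
  "moment bernoulli (binomial_poly k) = (-1) ^ k / (real k + 1)"
  using moment_bernoulli_shift[of "binomial_poly (Suc k)"]
  unfolding binomial_poly_shift coeff_binomial_poly_1 .

section \<open>The orthogonal polynomials\<close>

text \<open>Closed form \<open>(n choose k) * (n + k choose k)\<close>. In the ratio form over the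
  reals the factor \<open>n - k\<close> makes all coefficients beyond \<open>k = n\<close>
  vanish.\<close>

primrec legendre_coeff :: "nat \<Rightarrow> nat \<Rightarrow> real" where
  "legendre_coeff n 0 = 1"
| "legendre_coeff n (Suc k) =
    (real n + real k + 1) * (real n - real k) / (real k + 1)\<^sup>2 * legendre_coeff n k"

definition bernoulli_orthopoly :: "nat \<Rightarrow> real poly" where
  "bernoulli_orthopoly n = (\<Sum>k\<le>n. smult (legendre_coeff n k) (binomial_poly k))"

lemma legendre_coeff_eq_0: "n < k \<Longrightarrow> legendre_coeff n k = 0"
proof (induction k)
  case (Suc k)
  then show ?case by (cases "n = k") auto
qed simp

lemma legendre_coeff_nonzero: "k \<le> n \<Longrightarrow> legendre_coeff n k \<noteq> 0"
  by (induction k) (auto simp: add_eq_0_iff_both_eq_0 add_nonneg_eq_0_iff)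

lemma bernoulli_orthopoly_eq_sum:
  "n \<le> m \<Longrightarrow> bernoulli_orthopoly n = (\<Sum>k\<le>m. smult (legendre_coeff n k) (binomial_poly k))"
  unfolding bernoulli_orthopoly_def
  by (rule sum.mono_neutral_left) (auto simp: legendre_coeff_eq_0)

lemma degree_bernoulli_orthopoly: "degree (bernoulli_orthopoly n) \<le> n"
  unfolding bernoulli_orthopoly_def
  by (rule degree_sum_le) (auto intro: order_trans[OF degree_smult_le] simp: degree_binomial_poly)

lemma lead_coeff_bernoulli_orthopoly: "coeff (bernoulli_orthopoly n) n \<noteq> 0"
proof -
  have "coeff (bernoulli_orthopoly n) n = (\<Sum>k\<in>{n}. legendre_coeff n k * coeff (binomial_poly k) n)"
    unfolding bernoulli_orthopoly_def coeff_sum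
    by (rule sum.mono_neutral_cong_right) (auto simp: coeff_eq_0 degree_binomial_poly)
  then show ?thesis
    by (simp add: lead_coeff_binomial_poly legendre_coeff_nonzero)
qed

text \<open>Neighbouring coefficients are polynomial multiples of one \<open>e\<close>, in closed
  form \<open>(n + k - 1)! / (k!\<^sup>2 * (n + 1 - k)!)\<close> for \<open>k \<le> n + 1\<close>.
  This avoids quotients whose denominators vanish near \<open>k = n\<close>.\<close>

lemma legendre_coeff_family:
  assumes "n \<ge> 1"
  shows "\<exists>e. legendre_coeff (n + 1) k = (real n + k) * (real n + k + 1) * e \<and>
    legendre_coeff n k = (real n + k) * (real n + 1 - k) * e \<and>
    legendre_coeff (n - 1) k = (real n - k) * (real n + 1 - k) * e \<and>
    (\<forall>l. k = Suc l \<longrightarrow> legendre_coeff n l = (real k)\<^sup>2 * e)"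
proof (induction k)
  case 0
  show ?case
    \<comment> \<open>At \<open>k = 0\<close> all three coefficients are 1, which forces this
      \<open>e\<close>.\<close>
    using assms by (intro exI[of _ "1 / (real n * (real n + 1))"]) (auto simp: add_nonneg_eq_0_iff)
next
  case (Suc k)
  then obtain e where e: "legendre_coeff (n + 1) k = (real n + k) * (real n + k + 1) * e"
    "legendre_coeff n k = (real n + k) * (real n + 1 - k) * e"
    "legendre_coeff (n - 1) k = (real n - k) * (real n + 1 - k) * e"
    by blast
  \<comment> \<open>Successive values of \<open>e\<close> have ratio
    \<open>(n + k) * (n + 1 - k) / (k + 1)\<^sup>2\<close>; \<open>d\<close> absorbs the
    denominator.\<close>
  define d where "d = e / (real k + 1)\<^sup>2"
  have "(real k + 1)\<^sup>2 \<noteq> 0" by (simp add: add_nonneg_eq_0_iff)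
  then have d: "e = (real k + 1)\<^sup>2 * d" by (simp add: d_def)
  have step: "legendre_coeff m (Suc k) = (real m + k + 1) * (real m - k) * r * d"
    if "legendre_coeff m k = r * e" for m r
    using \<open>(real k + 1)\<^sup>2 \<noteq> 0\<close> by (simp add: that d)
  have "real (n - 1) = real n - 1" using assms by simp
  then have "legendre_coeff (n + 1) (Suc k) =
      (real n + real (Suc k)) * (real n + real (Suc k) + 1) * ((real n + k) * (real n + 1 - k) * d)"
    "legendre_coeff n (Suc k) =
      (real n + real (Suc k)) * (real n + 1 - real (Suc k)) * ((real n + k) * (real n + 1 - k) * d)"
    "legendre_coeff (n - 1) (Suc k) =
      (real n - real (Suc k)) * (real n + 1 - real (Suc k)) * ((real n + k) * (real n + 1 - k) * d)"
    "legendre_coeff n k = (real (Suc k))\<^sup>2 * ((real n + k) * (real n + 1 - k) * d)"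
    by (simp_all only: step[OF e(1)] step[OF e(2)] step[OF e(3)] e(2) d, simp_all add: algebra_simps)
  then show ?case
    by (intro exI[of _ "(real n + k) * (real n + 1 - k) * d"] conjI) auto
qed

text \<open>After substituting the multiples of the common \<open>e\<close>, a polynomial identity
  in \<open>n\<close> and \<open>k\<close> remains.\<close>

lemma legendre_coeff_recurrence:
  assumes "n \<ge> 1"
  shows "(real n + 1)\<^sup>2 * legendre_coeff (n + 1) k =
    (2 * real n + 1) * (2 * real k * legendre_coeff n (k - 1) + (2 * real k + 1) * legendre_coeff n k)
    + (real n)\<^sup>2 * legendre_coeff (n - 1) k"
proof -
  obtain e where e: "legendre_coeff (n + 1) k = (real n + k) * (real n + k + 1) * e"
    "legendre_coeff n k = (real n + k) * (real n + 1 - k) * e"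
    "legendre_coeff (n - 1) k = (real n - k) * (real n + 1 - k) * e"
    "\<forall>l. k = Suc l \<longrightarrow> legendre_coeff n l = (real k)\<^sup>2 * e"
    using legendre_coeff_family[OF assms, of k] by (elim exE conjE) (rule that)
  \<comment> \<open>The factor \<open>k\<close> covers \<open>k = 0\<close>, where the truncated
    \<open>k - 1\<close> refers to a coefficient that is not 0.\<close>
  have pred: "real k * legendre_coeff n (k - 1) = real k ^ 3 * e"
    using e(4) by (cases k) (auto simp: power3_eq_cube power2_eq_square)
  have "2 * real k * legendre_coeff n (k - 1) = 2 * (real k ^ 3 * e)"
    using pred by simp
  then show ?thesis
    unfolding e(1-3) by (simp only:) (simp add: power3_eq_cube power2_eq_square algebra_simps)
qed

text \<open>Comparison of coefficients in the binomial basis, with all sums extended to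
  \<open>n + 2\<close>; the index is raised by one to avoid \<open>n - 1\<close>.\<close>

lemma bernoulli_orthopoly_recurrence:
  "smult ((real n + 2)\<^sup>2) (bernoulli_orthopoly (n + 2)) =
    smult (2 * real n + 3) (smult 2 (pCons 0 (bernoulli_orthopoly (n + 1))) + bernoulli_orthopoly (n + 1))
    + smult ((real n + 1)\<^sup>2) (bernoulli_orthopoly n)"
proof -
  let ?c = legendre_coeff and ?b = binomial_poly
  have "pCons 0 (bernoulli_orthopoly (n + 1)) = [:0, 1:] * bernoulli_orthopoly (n + 1)"
    by simp
  also have "\<dots> = (\<Sum>k\<le>n + 1. smult (?c (n + 1) k) (pCons 0 (?b k)))"
    unfolding bernoulli_orthopoly_def sum_distrib_left by (intro sum.cong) auto
  also have "\<dots> = (\<Sum>k\<le>n + 1. smult (real (Suc k) * ?c (n + 1) k) (?b (Suc k))) +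
      (\<Sum>k\<le>n + 1. smult (real k * ?c (n + 1) k) (?b k))"
    unfolding pCons_0_binomial_poly sum.distrib[symmetric]
    by (intro sum.cong) (simp_all add: smult_add_right algebra_simps del: binomial_poly.simps)
  \<comment> \<open>Reindexing; the added term \<open>k = 0\<close> carries the factor 0.\<close>
  also have "(\<Sum>k\<le>n + 1. smult (real (Suc k) * ?c (n + 1) k) (?b (Suc k))) =
      (\<Sum>k\<le>n + 2. smult (real k * ?c (n + 1) (k - 1)) (?b k))"
    using sum.atMost_Suc_shift[of "\<lambda>k. smult (real k * ?c (n + 1) (k - 1)) (?b k)" "n + 1"]
    by (simp del: binomial_poly.simps legendre_coeff.simps sum.atMost_Suc)
  also have "(\<Sum>k\<le>n + 1. smult (real k * ?c (n + 1) k) (?b k)) =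
      (\<Sum>k\<le>n + 2. smult (real k * ?c (n + 1) k) (?b k))"
    by (rule sum.mono_neutral_left) (auto simp: legendre_coeff_eq_0)
  finally have x: "pCons 0 (bernoulli_orthopoly (n + 1)) =
      (\<Sum>k\<le>n + 2. smult (real k * ?c (n + 1) (k - 1) + real k * ?c (n + 1) k) (?b k))"
    by (simp only: smult_add_left sum.distrib)
  have smult_basis_sum: "smult a (\<Sum>k\<le>n + 2. smult (f k) (?b k)) = (\<Sum>k\<le>n + 2. smult (a * f k) (?b k))"
    for a and f :: "nat \<Rightarrow> real"
    by (simp only: smult_sum_right smult_smult)
  have rec: "(real n + 2)\<^sup>2 * ?c (n + 2) k =
      (2 * real n + 3) * (2 * (real k * ?c (n + 1) (k - 1) + real k * ?c (n + 1) k) + ?c (n + 1) k) +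
      (real n + 1)\<^sup>2 * ?c n k" for k
    using legendre_coeff_recurrence[of "n + 1" k] by (simp add: algebra_simps)
  have Q: "bernoulli_orthopoly m = (\<Sum>k\<le>n + 2. smult (?c m k) (?b k))" if "m \<le> n + 2" for m
    using that by (rule bernoulli_orthopoly_eq_sum)
  have Q': "bernoulli_orthopoly (n + 2) = (\<Sum>k\<le>n + 2. smult (?c (n + 2) k) (?b k))"
    "bernoulli_orthopoly (n + 1) = (\<Sum>k\<le>n + 2. smult (?c (n + 1) k) (?b k))"
    "bernoulli_orthopoly n = (\<Sum>k\<le>n + 2. smult (?c n k) (?b k))"
    by (rule Q, simp)+
  show ?thesis
    unfolding x unfolding Q'
    by (simp only: smult_add_right smult_basis_sum rec
        flip: sum.distrib smult_add_left)
qed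

text \<open>The analogue of the vanishing integral of a nonconstant Legendre polynomial, proved by
  telescoping.\<close>

lemma moment_bernoulli_orthopoly:
  assumes "n \<ge> 1"
  shows "moment bernoulli (bernoulli_orthopoly n) = 0"
proof -
  define t where "t k = legendre_coeff n k * (-1) ^ k / (real k + 1)" for k
  have step: "(real m + 1) * (real m + 2) * t (Suc m) = - (real n + m + 1) * (real n - m) * t m" for m
    unfolding t_def by (simp add: divide_simps power2_eq_square) (simp add: algebra_simps)
  \<comment> \<open>The partial sums have a closed form, which vanishes at \<open>m = n + 1\<close>.\<close>
  have "real n * (real n + 1) * (\<Sum>k<m. t k) = - (real m * (real m + 1) * t m)" for m
  proof (induction m)
    case (Suc m)
    have "real n * (real n + 1) * (\<Sum>k<Suc m. t k) =
        - (real m * (real m + 1) * t m) + real n * (real n + 1) * t m"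
      using Suc by (simp add: algebra_simps)
    \<comment> \<open>Uses \<open>n * (n + 1) - m * (m + 1) = (n + m + 1) * (n - m)\<close>.\<close>
    also have "\<dots> = - (- (real n + m + 1) * (real n - m) * t m)"
      by (simp add: algebra_simps)
    also have "\<dots> = - ((real m + 1) * (real m + 2) * t (Suc m))"
      by (simp only: step)
    finally show ?case by (simp add: algebra_simps)
  qed simp
  from this[of "Suc n"] have "(\<Sum>k<Suc n. t k) = 0"
    using assms by (simp add: t_def[of "Suc n"] legendre_coeff_eq_0 del: sum.lessThan_Suc legendre_coeff.simps)
  then show ?thesis
    by (simp add: bernoulli_orthopoly_def moment_sum moment_smult moment_bernoulli_binomial_poly
        t_def lessThan_Suc_atMost)
qed

section \<open>Orthogonality and the diagonal moments\<close>

definition bernoulli_moment :: "nat \<Rightarrow> nat \<Rightarrow> real" where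
  "bernoulli_moment i n = moment (\<lambda>k. bernoulli (i + k)) (bernoulli_orthopoly n)"

lemma bernoulli_moment_recurrence:
  "(real n + 2)\<^sup>2 * bernoulli_moment i (n + 2) =
    (2 * real n + 3) * (2 * bernoulli_moment (Suc i) (n + 1) + bernoulli_moment i (n + 1))
    + (real n + 1)\<^sup>2 * bernoulli_moment i n"
  using arg_cong[OF bernoulli_orthopoly_recurrence, of "moment (\<lambda>k. bernoulli (i + k))" n]
  by (simp add: moment_add moment_smult moment_pCons bernoulli_moment_def)

text \<open>The recurrence expresses the moment for \<open>Suc i\<close> and \<open>m + 1\<close> by
  those for \<open>i\<close> and \<open>m\<close>, \<open>m + 1\<close>, \<open>m + 2\<close>, which
  vanish by induction.\<close>

lemma bernoulli_moment_eq_0: "i < n \<Longrightarrow> bernoulli_moment i n = 0"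
proof (induction i arbitrary: n)
  case 0
  then show ?case by (simp add: bernoulli_moment_def moment_bernoulli_orthopoly)
next
  case (Suc i)
  then obtain m where m: "n = m + 1" "i < m" by (cases n) auto
  then show ?case
    using bernoulli_moment_recurrence[of m i] Suc.IH[of m] Suc.IH[of "m + 1"] Suc.IH[of "m + 2"]
    by auto
qed

lemma bernoulli_orthopoly_0 [simp]: "bernoulli_orthopoly 0 = 1"
  by (simp add: bernoulli_orthopoly_def)

lemma bernoulli_0: "bernoulli 0 = 1"
  using moment_bernoulli_binomial_poly[of 0] by (simp add: moment_def)

text \<open>At \<open>i = n\<close> orthogonality removes two terms of the recurrence, leaving a
  first-order one along the diagonal.\<close>

lemma bernoulli_moment_diag:
  "bernoulli_moment n n = (-1) ^ n * (fact n) ^ 3 / fact (2 * n + 1)"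
proof (induction n)
  case 0
  then show ?case by (simp add: bernoulli_moment_def moment_def bernoulli_0)
next
  case (Suc n)
  have "2 * (2 * real n + 3) * bernoulli_moment (Suc n) (Suc n) = - (real n + 1)\<^sup>2 * bernoulli_moment n n"
    using bernoulli_moment_recurrence[of n n] by (simp add: bernoulli_moment_eq_0 algebra_simps)
  then have "bernoulli_moment (Suc n) (Suc n) =
      - (real n + 1)\<^sup>2 / (2 * (2 * real n + 3)) * bernoulli_moment n n"
    by (simp add: field_simps)
  also have "\<dots> = (-1) ^ Suc n * (fact (Suc n)) ^ 3 / fact (2 * Suc n + 1)"
  proof -
    have "fact (2 * Suc n + 1) = (2 * real n + 3) * (2 * (real n + 1)) * fact (2 * n + 1)"
      by (simp add: algebra_simps)
    \<comment> \<open>The sign and the factorials are abstracted to variables, so that only field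
      arithmetic remains.\<close>
    moreover have "- a\<^sup>2 / (2 * b) * (s * F ^ 3 / G) = - s * (a * F) ^ 3 / (b * (2 * a) * G)"
      if "a \<noteq> 0" "b \<noteq> 0" "G \<noteq> 0" for a b s F G :: real
      using that by (simp add: field_simps power2_eq_square power3_eq_cube)
    from this[of "real n + 1" "2 * real n + 3" "fact (2 * n + 1)" "(-1) ^ n" "fact n"]
    have "- (real n + 1)\<^sup>2 / (2 * (2 * real n + 3)) * ((-1) ^ n * fact n ^ 3 / fact (2 * n + 1)) =
        - ((-1) ^ n) * ((real n + 1) * fact n) ^ 3 /
          ((2 * real n + 3) * (2 * (real n + 1)) * fact (2 * n + 1))"
      by (simp add: add_nonneg_eq_0_iff)
    moreover have "- ((-1) ^ n) = ((-1) ^ Suc n :: real)" "(real n + 1) * fact n = fact (Suc n)"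
      by (simp_all add: add.commute)
    ultimately show ?thesis
      unfolding Suc by (simp only:)
  qed
  finally show ?case .
qed

section \<open>The shifted functional\<close>

definition shifted_moment :: "nat \<Rightarrow> real" where
  "shifted_moment n = moment shifted_bernoulli (bernoulli_orthopoly n)"

text \<open>The constant coefficient \<open>c\<close> is lost because it meets
  \<open>shifted_bernoulli 0 = 0\<close>.\<close>

lemma moment_shifted_bernoulli_pCons:
  "moment shifted_bernoulli (pCons c p) = moment bernoulli p"
  by (simp add: moment_pCons shifted_bernoulli_def)

text \<open>The term with \<open>x * Q (n + 1)\<close> contributes a multiple of
  \<open>L (Q (n + 1)) = 0\<close>.\<close>

lemma shifted_moment_recurrence:
  "(real n + 2)\<^sup>2 * shifted_moment (n + 2) =
    (2 * real n + 3) * shifted_moment (n + 1) + (real n + 1)\<^sup>2 * shifted_moment n"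
  using arg_cong[OF bernoulli_orthopoly_recurrence, of "moment shifted_bernoulli" n]
  by (simp add: moment_add moment_smult moment_shifted_bernoulli_pCons moment_bernoulli_orthopoly
      shifted_moment_def)

text \<open>Since \<open>2 * n + 3 = (n + 2)\<^sup>2 - (n + 1)\<^sup>2\<close>, the recurrence says
  that the left-hand side changes sign at each step.\<close>

lemma shifted_moment_diff:
  "(real n + 1)\<^sup>2 * (shifted_moment (Suc n) - shifted_moment n) = 2 * (-1) ^ n"
proof (induction n)
  case 0
  have "shifted_moment 0 = 0"
    by (simp add: shifted_moment_def moment_def shifted_bernoulli_def)
  moreover have "bernoulli_orthopoly (Suc 0) = [:1, 2:]"
    by (simp add: bernoulli_orthopoly_def)
  then have "shifted_moment (Suc 0) = 2"
    by (simp add: shifted_moment_def moment_pCons shifted_bernoulli_def bernoulli_0)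
  ultimately show ?case by simp
next
  case (Suc n)
  have "(real n + 2)\<^sup>2 * (shifted_moment (n + 2) - shifted_moment (n + 1)) =
      - ((real n + 1)\<^sup>2 * (shifted_moment (n + 1) - shifted_moment n))"
    using shifted_moment_recurrence[of n] by (simp add: power2_eq_square algebra_simps)
  then show ?case using Suc by (simp add: add.commute)
qed

lemma shifted_moment_eq: "shifted_moment n = 2 * alternating_harmonic2 n"
proof (induction n)
  case 0
  show ?case
    by (simp add: shifted_moment_def moment_def shifted_bernoulli_def alternating_harmonic2_def)
next
  case (Suc n)
  have "(real n + 1)\<^sup>2 \<noteq> 0" by (simp add: add_nonneg_eq_0_iff)
  then have "shifted_moment (Suc n) = shifted_moment n + 2 * (-1) ^ n / (real n + 1)\<^sup>2"
    using shifted_moment_diff[of n] by (simp add: field_simps)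
  then show ?case
    unfolding Suc by (simp add: alternating_harmonic2_def algebra_simps)
qed

section \<open>Evaluation of the two determinants\<close>

lemma hankel_det_bernoulli:
  "hankel_det bernoulli n * (\<Prod>j<Suc n. coeff (bernoulli_orthopoly j) j) =
    (\<Prod>i<Suc n. bernoulli_moment i i)"
proof -
  let ?A = "mat (Suc n) (Suc n) (\<lambda>(i, j). bernoulli_moment i j)"
  have "det ?A = prod_list (diag_mat ?A)"
    by (rule det_lower_triangular[of "Suc n"]) (auto simp: bernoulli_moment_eq_0)
  then show ?thesis
    using hankel_det_triangular_basis[of bernoulli_orthopoly bernoulli n, OF degree_bernoulli_orthopoly]
    by (simp add: prod_list_diag_prod atLeast0LessThan bernoulli_moment_def)
qed

text \<open>Row \<open>Suc i\<close> holds the moments \<open>L (x ^ i * Q j)\<close>, so by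
  orthogonality the last column vanishes below its top entry \<open>N (Q n)\<close>. Expanding along
  it leaves a lower triangular minor.\<close>

lemma hankel_det_shifted_bernoulli:
  "hankel_det shifted_bernoulli n * (\<Prod>j<Suc n. coeff (bernoulli_orthopoly j) j) =
    (-1) ^ n * shifted_moment n * (\<Prod>i<n. bernoulli_moment i i)"
proof -
  let ?A = "mat (Suc n) (Suc n)
    (\<lambda>(i, j). moment (\<lambda>k. shifted_bernoulli (i + k)) (bernoulli_orthopoly j))"
  have entry: "moment (\<lambda>k. shifted_bernoulli (Suc i + k)) (bernoulli_orthopoly j) = bernoulli_moment i j"
    for i j by (simp add: bernoulli_moment_def shifted_bernoulli_def)
  have "det ?A = (\<Sum>i<Suc n. ?A $$ (i, n) * cofactor ?A i n)"
    by (rule laplace_expansion_column[of _ "Suc n"]) auto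
  also have "\<dots> = (\<Sum>i\<in>{0}. ?A $$ (i, n) * cofactor ?A i n)"
  proof (rule sum.mono_neutral_right)
    show "\<forall>i\<in>{..<Suc n} - {0}. ?A $$ (i, n) * cofactor ?A i n = 0"
    proof
      fix i assume "i \<in> {..<Suc n} - {0}"
      then obtain l where "i = Suc l" "l < n" by (cases i) auto
      then show "?A $$ (i, n) * cofactor ?A i n = 0"
        using entry[of l n] by (simp add: bernoulli_moment_eq_0)
    qed
  qed auto
  also have "\<dots> = (-1) ^ n * shifted_moment n * det (mat_delete ?A 0 n)"
    by (simp add: cofactor_def shifted_moment_def)
  also have "mat_delete ?A 0 n = mat n n (\<lambda>(i, j). bernoulli_moment i j)"
    using entry by (intro eq_matI) (auto simp: mat_delete_def)
  also have "det \<dots> = prod_list (diag_mat (mat n n (\<lambda>(i, j). bernoulli_moment i j)))"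
    by (rule det_lower_triangular[of n]) (auto simp: bernoulli_moment_eq_0)
  also have "\<dots> = (\<Prod>i<n. bernoulli_moment i i)"
    by (simp add: prod_list_diag_prod atLeast0LessThan)
  finally show ?thesis
    using hankel_det_triangular_basis[of bernoulli_orthopoly shifted_bernoulli n,
        OF degree_bernoulli_orthopoly]
    by simp
qed

theorem proposition3p1:
  fixes n :: nat
  assumes "n \<ge> 1"
  shows "hankel_det shifted_bernoulli n =
    2 * fact (2 * n + 1) / (fact n) ^ 3 * alternating_harmonic2 n * hankel_det bernoulli n"
proof -
  let ?q = "\<Prod>j<Suc n. coeff (bernoulli_orthopoly j) j"
  let ?c = "2 * fact (2 * n + 1) / (fact n) ^ 3 * alternating_harmonic2 n"
  have "?q \<noteq> 0"
    by (simp add: lead_coeff_bernoulli_orthopoly)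
  have "?c * hankel_det bernoulli n * ?q = ?c * bernoulli_moment n n * (\<Prod>i<n. bernoulli_moment i i)"
    using hankel_det_bernoulli[of n] by (simp only: mult.assoc) simp
  \<comment> \<open>The factorials cancel against the diagonal moment, whose sign is that of the
    corner cofactor.\<close>
  also have "?c * bernoulli_moment n n = (-1) ^ n * shifted_moment n"
    unfolding bernoulli_moment_diag shifted_moment_eq by simp
  also have "(-1) ^ n * shifted_moment n * (\<Prod>i<n. bernoulli_moment i i) =
      hankel_det shifted_bernoulli n * ?q"
    by (simp only: hankel_det_shifted_bernoulli)
  finally show ?thesis
    by (simp only: mult_right_cancel[OF \<open>?q \<noteq> 0\<close>])
qed

end
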